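(* Let $(X,\mathcal F,\mu)$ be a measure space with $\mu$ sigma-finite, and let $\mathcal F^{\rm fin}=\{A\in\mathcal F:\mu(A)<\infty\}$. Let $M:\mathcal F^{\rm fin}\to\mathbb C$ be a (finitely) additive function such that, for every $A\in\mathcal F^{\rm fin}$, $\mu(A)=0$ implies $M(A)=0$. Then the following three conditions are equivalent: (1) There exists $h\in\mathbf L^2(X,\mathcal F,\mu)$ such that $$M(A)=\int_A h(x)\,\mu(dx),\quad A\in\mathcal F^{\rm fin}.$$ (2) There exists a constant $C<\infty$ such that, for every $N\in\mathbb N$ and every family $A_1,\ldots,A_N$ of pairwise disjoint elements of $\mathcal F^{\rm fin}$, $$\sum_{n=1}^N\frac{|M(A_n)|^2}{\mu(A_n)}\le C,$$ where a term with $\mu(A_n)=0$ (and hence $M(A_n)=0$) is read as $0$. (3) $M\in\mathfrak H(\mu)$.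
   Context: $\mathfrak H(\mu)$ denotes the reproducing kernel Hilbert space of complex-valued functions on the set $\mathcal F^{\rm fin}$ whose reproducing kernel is the positive definite function $K^{(\mu)}(A,B)=\mu(A\cap B)$, $A,B\in\mathcal F^{\rm fin}$. The functions in $\mathbf L^2(X,\mathcal F,\mu)$ are complex-valued. *)

theory Defs
  imports "HOL-Analysis.Analysis"
begin

section \<open>Reproducing kernel Hilbert spaces of complex-valued functions on a set\<close>

text \<open>A function on \<open>S\<close> is represented by the total function that agrees with it on \<open>S\<close> and
  is \<open>0\<close> outside \<open>S\<close>; without such a normalisation a Hilbert space of total functions would not
  be determined by its kernel on \<open>S\<close>.\<close>

definition zero_off :: "'a set \<Rightarrow> ('a \<Rightarrow> complex) \<Rightarrow> 'a \<Rightarrow> complex" where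
  "zero_off S f = (\<lambda>x. if x \<in> S then f x else 0)"

text \<open>\<open>H\<close> with the inner product \<open>ip\<close> (linear in the first argument) is a complex Hilbert space
  of functions on \<open>S\<close> with reproducing kernel \<open>K\<close>. The inner product matters only on \<open>H\<close>.\<close>

locale reproducing_kernel_space =
  fixes S :: "'a set" and K :: "'a \<Rightarrow> 'a \<Rightarrow> complex"
    and H :: "('a \<Rightarrow> complex) set"
    and ip :: "('a \<Rightarrow> complex) \<Rightarrow> ('a \<Rightarrow> complex) \<Rightarrow> complex"
  assumes vanish: "\<And>f x. f \<in> H \<Longrightarrow> x \<notin> S \<Longrightarrow> f x = 0"
    and zero_mem: "(\<lambda>x. 0) \<in> H"
    and add_mem: "\<And>f g. f \<in> H \<Longrightarrow> g \<in> H \<Longrightarrow> (\<lambda>x. f x + g x) \<in> H"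
    and scale_mem: "\<And>c f. f \<in> H \<Longrightarrow> (\<lambda>x. c * f x) \<in> H"
    and ip_add_left: "\<And>f g k. f \<in> H \<Longrightarrow> g \<in> H \<Longrightarrow> k \<in> H \<Longrightarrow>
          ip (\<lambda>x. f x + g x) k = ip f k + ip g k"
    and ip_scale_left: "\<And>c f g. f \<in> H \<Longrightarrow> g \<in> H \<Longrightarrow> ip (\<lambda>x. c * f x) g = c * ip f g"
    and ip_commute: "\<And>f g. f \<in> H \<Longrightarrow> g \<in> H \<Longrightarrow> ip g f = cnj (ip f g)"
    and ip_pos: "\<And>f. f \<in> H \<Longrightarrow> f \<noteq> (\<lambda>x. 0) \<Longrightarrow> Re (ip f f) > 0"
    and complete: "\<And>F :: nat \<Rightarrow> 'a \<Rightarrow> complex. (\<And>n. F n \<in> H) \<Longrightarrow>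
          (\<And>e. e > 0 \<Longrightarrow> \<exists>N. \<forall>m\<ge>N. \<forall>n\<ge>N.
             sqrt (Re (ip (\<lambda>x. F m x - F n x) (\<lambda>x. F m x - F n x))) < e) \<Longrightarrow>
          \<exists>f\<in>H. (\<lambda>n. sqrt (Re (ip (\<lambda>x. F n x - f x) (\<lambda>x. F n x - f x)))) \<longlonglongrightarrow> 0"
    and kernel_mem: "\<And>y. y \<in> S \<Longrightarrow> zero_off S (\<lambda>x. K x y) \<in> H"
    and reproducing: "\<And>f y. f \<in> H \<Longrightarrow> y \<in> S \<Longrightarrow> ip f (zero_off S (\<lambda>x. K x y)) = f y"

text \<open>The underlying set of functions of the reproducing kernel Hilbert space with kernel \<open>K\<close>.
  It is unique, as shown below; it exists for every positive definite kernel (Moore--Aronszajn).\<close>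

definition rkhs :: "'a set \<Rightarrow> ('a \<Rightarrow> 'a \<Rightarrow> complex) \<Rightarrow> ('a \<Rightarrow> complex) set" where
  "rkhs S K = (THE H. \<exists>ip. reproducing_kernel_space S K H ip)"


subsection \<open>Uniqueness\<close>

inductive_set kernel_span :: "'a set \<Rightarrow> ('a \<Rightarrow> 'a \<Rightarrow> complex) \<Rightarrow> ('a \<Rightarrow> complex) set"
  for S K where
  zero: "(\<lambda>x. 0) \<in> kernel_span S K"
| step: "f \<in> kernel_span S K \<Longrightarrow> y \<in> S \<Longrightarrow>
    (\<lambda>x. f x + c * zero_off S (\<lambda>x. K x y) x) \<in> kernel_span S K"

lemma kernel_span_add:
  assumes "f \<in> kernel_span S K" "g \<in> kernel_span S K"
  shows "(\<lambda>x. f x + g x) \<in> kernel_span S K"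
  using assms(2)
proof induction
  case zero
  then show ?case using assms(1) by simp
next
  case (step g y c)
  from kernel_span.step[OF step.IH step.hyps(2), of c] show ?case by (simp add: add.assoc)
qed

lemma kernel_span_scale:
  assumes "f \<in> kernel_span S K"
  shows "(\<lambda>x. a * f x) \<in> kernel_span S K"
  using assms
proof induction
  case zero
  then show ?case using kernel_span.zero by simp
next
  case (step f y c)
  from kernel_span.step[OF step.IH step.hyps(2), of "a * c"]
  show ?case by (simp add: distrib_left mult.assoc)
qed

lemma kernel_mem_span: "y \<in> S \<Longrightarrow> zero_off S (\<lambda>x. K x y) \<in> kernel_span S K"
  using kernel_span.step[OF kernel_span.zero, of y S 1 K] by simp

context reproducing_kernel_space
begin

lemma diff_mem: "f \<in> H \<Longrightarrow> g \<in> H \<Longrightarrow> (\<lambda>x. f x - g x) \<in> H"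
  using add_mem[OF _ scale_mem[of g "-1"], of f] by simp

lemma ip_diff_left:
  assumes "f \<in> H" "g \<in> H" "k \<in> H"
  shows "ip (\<lambda>x. f x - g x) k = ip f k - ip g k"
  using ip_add_left[OF assms(1) scale_mem[OF assms(2), of "-1"] assms(3)]
    ip_scale_left[OF assms(2,3), of "-1"] by simp

lemma ip_add_right:
  assumes "f \<in> H" "g \<in> H" "k \<in> H"
  shows "ip k (\<lambda>x. f x + g x) = ip k f + ip k g"
  using assms ip_commute[of "\<lambda>x. f x + g x" k] ip_commute[of f k] ip_commute[of g k]
  by (simp add: add_mem ip_add_left)

lemma ip_diff_right:
  assumes "f \<in> H" "g \<in> H" "k \<in> H"
  shows "ip k (\<lambda>x. f x - g x) = ip k f - ip k g"
  using assms ip_commute[of "\<lambda>x. f x - g x" k] ip_commute[of f k] ip_commute[of g k]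
  by (simp add: diff_mem ip_diff_left)

lemma ip_scale_right:
  assumes "f \<in> H" "g \<in> H"
  shows "ip g (\<lambda>x. c * f x) = cnj c * ip g f"
  using assms ip_commute[of "\<lambda>x. c * f x" g] ip_commute[of f g]
  by (simp add: scale_mem ip_scale_left)

lemma ip_zero_left: "g \<in> H \<Longrightarrow> ip (\<lambda>x. 0) g = 0"
  using ip_scale_left[OF zero_mem, of g 0] by simp

lemma ip_self_nonneg: "f \<in> H \<Longrightarrow> Re (ip f f) \<ge> 0"
  using ip_pos[of f] ip_zero_left[OF zero_mem] by (cases "f = (\<lambda>x. 0)") auto

lemma ip_self_real: "f \<in> H \<Longrightarrow> ip f f = of_real (Re (ip f f))"
  using ip_commute[of f f] by (simp add: complex_eq_iff)

lemma ip_diff_self: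
  assumes "f \<in> H" "g \<in> H"
  shows "Re (ip (\<lambda>x. f x - g x) (\<lambda>x. f x - g x)) = Re (ip f f) + Re (ip g g) - 2 * Re (ip f g)"
  using assms ip_commute[of f g] by (simp add: ip_diff_left ip_diff_right diff_mem)

lemma project:
  assumes r: "r \<in> H" and k: "k \<in> H" and pos: "Re (ip k k) > 0"
  defines "c \<equiv> ip r k / of_real (Re (ip k k))"
  shows "Re (ip (\<lambda>x. r x - c * k x) (\<lambda>x. r x - c * k x))
    = Re (ip r r) - (cmod (ip r k))\<^sup>2 / Re (ip k k)"
proof -
  define q where "q = Re (ip k k)"
  define z where "z = ip r k"
  have q: "q > 0" using pos by (simp add: q_def)
  have kk: "ip k k = of_real q" using ip_self_real[OF k] by (simp add: q_def)
  have c: "c = z / of_real q" by (simp add: c_def q_def z_def)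
  have 1: "ip (\<lambda>x. c * k x) (\<lambda>x. c * k x) = c * (cnj c * of_real q)"
    using k kk by (simp add: ip_scale_left ip_scale_right scale_mem)
  have 2: "ip r (\<lambda>x. c * k x) = cnj c * z"
    using r k by (simp add: ip_scale_right z_def)
  have e1: "c * (cnj c * of_real q) = of_real ((cmod z)\<^sup>2 / q)"
  proof -
    have "c * (cnj c * of_real q) = (z * cnj z) / of_real q"
      using q by (simp add: c field_simps)
    then show ?thesis by (simp add: complex_norm_square del: of_real_power)
  qed
  have e2: "cnj c * z = of_real ((cmod z)\<^sup>2 / q)"
    by (simp add: c complex_norm_square[symmetric] mult.commute)
  have "Re (ip (\<lambda>x. r x - c * k x) (\<lambda>x. r x - c * k x))
      = Re (ip r r) + (cmod z)\<^sup>2 / q - 2 * ((cmod z)\<^sup>2 / q)"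
    using ip_diff_self[OF r scale_mem[OF k, of c]] 1 2 e1 e2 by (metis Re_complex_of_real)
  then show ?thesis by (simp add: q_def z_def)
qed

lemma ip_zero_right: "g \<in> H \<Longrightarrow> ip g (\<lambda>x. 0) = 0"
  using ip_scale_right[OF zero_mem, of g 0] by simp

lemma near_projection:
  assumes r: "r \<in> H" and k: "k \<in> H"
    and min: "\<And>c. Re (ip (\<lambda>x. r x - c * k x) (\<lambda>x. r x - c * k x)) \<ge> d"
  shows "(cmod (ip r k))\<^sup>2 \<le> (Re (ip r r) - d) * Re (ip k k)"
proof (cases "k = (\<lambda>x. 0)")
  case True
  then show ?thesis using r ip_zero_right ip_zero_left[OF zero_mem] by simp
next
  case False
  then have p: "Re (ip k k) > 0" using ip_pos[OF k] by simp
  have "d \<le> Re (ip r r) - (cmod (ip r k))\<^sup>2 / Re (ip k k)"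
    using project[OF r k p] min by metis
  then show ?thesis using p by (simp add: field_simps)
qed

lemma cauchy_schwarz:
  assumes "r \<in> H" "k \<in> H"
  shows "(cmod (ip r k))\<^sup>2 \<le> Re (ip r r) * Re (ip k k)"
  using near_projection[OF assms, of 0] assms
  by (simp add: ip_self_nonneg diff_mem scale_mem)

lemma kernel_span_subset: "kernel_span S K \<subseteq> H"
proof
  fix f assume "f \<in> kernel_span S K"
  then show "f \<in> H" by induction (auto intro!: zero_mem add_mem scale_mem kernel_mem)
qed

end

lemma reproducing_kernel_space_ip_eq:
  assumes "reproducing_kernel_space S K H ip" and "reproducing_kernel_space S K H' ip'"
    and g: "g \<in> kernel_span S K" and f: "f \<in> kernel_span S K"
  shows "ip g f = ip' g f"
proof -
  interpret A: reproducing_kernel_space S K H ip by fact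
  interpret B: reproducing_kernel_space S K H' ip' by fact
  have gA: "g \<in> H" and gB: "g \<in> H'"
    using g A.kernel_span_subset B.kernel_span_subset by auto
  show ?thesis using f
  proof induction
    case zero
    then show ?case using gA gB by (simp add: A.ip_zero_right B.ip_zero_right)
  next
    case (step f y c)
    have "f \<in> H" "f \<in> H'"
      using step A.kernel_span_subset B.kernel_span_subset by auto
    then show ?case using step gA gB
      by (simp add: A.ip_add_right A.ip_scale_right A.scale_mem A.kernel_mem A.reproducing
          B.ip_add_right B.ip_scale_right B.scale_mem B.kernel_mem B.reproducing)
  qed
qed

lemma reproducing_kernel_space_subset:
  assumes "reproducing_kernel_space S K H ip" and "reproducing_kernel_space S K H' ip'"
  shows "H \<subseteq> H'"
proof
  fix f assume f: "f \<in> H"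
  interpret A: reproducing_kernel_space S K H ip by fact
  interpret B: reproducing_kernel_space S K H' ip' by fact
  let ?nA = "\<lambda>f. Re (ip f f)" and ?nB = "\<lambda>f. Re (ip' f f)"
  have spA: "g \<in> H" and spB: "g \<in> H'" if "g \<in> kernel_span S K" for g
    using that A.kernel_span_subset B.kernel_span_subset by auto
  define D where "D = (\<lambda>g. ?nA (\<lambda>x. f x - g x)) ` kernel_span S K"
  define d where "d = Inf D"
  have bdd: "bdd_below D"
    unfolding D_def
    by (rule bdd_belowI[of _ 0]) (use A.ip_self_nonneg[OF A.diff_mem[OF f spA]] in auto)
  have ne: "D \<noteq> {}" using kernel_span.zero by (auto simp: D_def)
  have dle: "d \<le> ?nA (\<lambda>x. f x - g x)" if "g \<in> kernel_span S K" for g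
    unfolding d_def by (rule cInf_lower[OF _ bdd]) (use that in \<open>auto simp: D_def\<close>)
  have "\<exists>g\<in>kernel_span S K. ?nA (\<lambda>x. f x - g x) < d + 1 / Suc n" for n
  proof -
    have "Inf D < d + 1 / Suc n" by (simp add: d_def)
    then obtain v where "v \<in> D" "v < d + 1 / Suc n"
      using cInf_lessD[OF ne] by blast
    then show ?thesis by (auto simp: D_def)
  qed
  then obtain G where G: "\<And>n. G n \<in> kernel_span S K"
    and Gd: "\<And>n. ?nA (\<lambda>x. f x - G n x) < d + 1 / Suc n"
    by metis
  have diff_span: "(\<lambda>x. g x - h x) \<in> kernel_span S K"
    if "g \<in> kernel_span S K" "h \<in> kernel_span S K" for g h
    using kernel_span_add[OF that(1) kernel_span_scale[OF that(2), of "-1"]] by simp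
  have Glim: "(\<lambda>n. G n y) \<longlonglongrightarrow> f y" if y: "y \<in> S" for y
  proof -
    let ?k = "zero_off S (\<lambda>x. K x y)"
    have bound: "(cmod (f y - G n y))\<^sup>2 \<le> (1 / Suc n) * ?nA ?k" for n
    proof -
      have r: "(\<lambda>x. f x - G n x) \<in> H" by (intro A.diff_mem f spA G)
      have k: "?k \<in> H" using y by (rule A.kernel_mem)
      have "d \<le> ?nA (\<lambda>x. (f x - G n x) - c * ?k x)" for c
        using dle[OF kernel_span.step[OF G y], of n c] by (simp add: algebra_simps)
      from A.near_projection[OF r k this]
      have "(cmod (f y - G n y))\<^sup>2 \<le> (?nA (\<lambda>x. f x - G n x) - d) * ?nA ?k"
        using A.reproducing[OF r y] by simp
      also have "\<dots> \<le> (1 / Suc n) * ?nA ?k"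
        using Gd[of n] A.ip_self_nonneg[OF k] by (intro mult_right_mono) auto
      finally show ?thesis .
    qed
    have "(\<lambda>n. (1 / Suc n) * ?nA ?k) \<longlonglongrightarrow> 0 * ?nA ?k"
      by (intro tendsto_mult tendsto_const) (use LIMSEQ_inverse_real_of_nat in \<open>simp add: inverse_eq_divide\<close>)
    then have "(\<lambda>n. (1 / Suc n) * ?nA ?k) \<longlonglongrightarrow> 0" by simp
    then have "(\<lambda>n. (cmod (f y - G n y))\<^sup>2) \<longlonglongrightarrow> 0"
      by (rule Lim_null_comparison[rotated]) (use bound in \<open>simp add: eventually_sequentially\<close>)
    from tendsto_real_sqrt[OF this] have "(\<lambda>n. cmod (f y - G n y)) \<longlonglongrightarrow> 0" by simp
    then have "(\<lambda>n. f y - G n y) \<longlonglongrightarrow> 0" by (rule tendsto_norm_zero_cancel)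
    from tendsto_diff[OF tendsto_const[of "f y"] this] show ?thesis by simp
  qed
  have para: "?nA (\<lambda>x. G m x - G n x) \<le> 2 / Suc m + 2 / Suc n" for m n
  proof -
    define a where "a = (\<lambda>x. f x - G m x)"
    define b where "b = (\<lambda>x. f x - G n x)"
    have ab: "a \<in> H" "b \<in> H" unfolding a_def b_def by (intro A.diff_mem f spA G)+
    have 1: "?nA (\<lambda>x. G m x - G n x) = ?nA a + ?nA b - 2 * Re (ip b a)"
      using A.ip_diff_self[OF ab(2,1)] by (simp add: a_def b_def)
    let ?h = "\<lambda>x. (1/2) * (G m x + G n x)"
    have h: "?h \<in> kernel_span S K" by (intro kernel_span_scale kernel_span_add G)
    have "(\<lambda>x. f x - ?h x) = (\<lambda>x. (1/2) * (a x + b x))"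
      by (auto simp: a_def b_def field_simps)
    then have "?nA (\<lambda>x. f x - ?h x) = Re ((1/2) * ((1/2) * ip (\<lambda>x. a x + b x) (\<lambda>x. a x + b x)))"
      using ab A.ip_scale_left[of "\<lambda>x. a x + b x" "\<lambda>x. (1/2) * (a x + b x)" "1/2"]
        A.ip_scale_right[of "\<lambda>x. a x + b x" "\<lambda>x. a x + b x" "1/2"]
      by (simp only: A.add_mem A.scale_mem) simp
    also have "\<dots> = (?nA a + ?nA b + 2 * Re (ip b a)) / 4"
      using ab A.ip_commute[of a b] by (simp add: A.ip_add_left A.ip_add_right A.add_mem)
    finally have "d \<le> (?nA a + ?nA b + 2 * Re (ip b a)) / 4" using dle[OF h] by simp
    moreover have "?nA a < d + 1 / Suc m" "?nA b < d + 1 / Suc n"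
      using Gd by (simp_all add: a_def b_def)
    moreover have "p + q - 2 * r \<le> 2 * u + 2 * v"
      if "d \<le> (p + q + 2 * r) / 4" "p < d + u" "q < d + v" for p q r u v :: real
      using that by simp
    ultimately have "?nA (\<lambda>x. G m x - G n x) \<le> 2 * (1 / Suc m) + 2 * (1 / Suc n)"
      unfolding 1 by blast
    then show ?thesis by simp
  qed
  have "\<exists>g\<in>H'. (\<lambda>n. sqrt (?nB (\<lambda>x. G n x - g x))) \<longlonglongrightarrow> 0"
  proof (rule B.complete)
    show "G n \<in> H'" for n by (rule spB[OF G])
    fix e :: real assume e: "e > 0"
    obtain N where N: "1 / Suc N < e\<^sup>2 / 4"
      using nat_approx_posE[of "e\<^sup>2 / 4"] e by auto
    have "sqrt (?nB (\<lambda>x. G m x - G n x)) < e" if "m \<ge> N" "n \<ge> N" for m n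
    proof -
      have "?nB (\<lambda>x. G m x - G n x) = ?nA (\<lambda>x. G m x - G n x)"
        using reproducing_kernel_space_ip_eq[OF assms diff_span[OF G G] diff_span[OF G G]] by simp
      also have "\<dots> \<le> 2 / Suc m + 2 / Suc n" by (rule para)
      also have "\<dots> \<le> 2 / Suc N + 2 / Suc N"
        using that by (intro add_mono divide_left_mono) auto
      also have "\<dots> < e\<^sup>2" using N by simp
      finally have "?nB (\<lambda>x. G m x - G n x) < e\<^sup>2" .
      then have "sqrt (?nB (\<lambda>x. G m x - G n x)) < sqrt (e\<^sup>2)"
        by (simp only: real_sqrt_less_iff)
      then show ?thesis using e by simp
    qed
    then show "\<exists>N. \<forall>m\<ge>N. \<forall>n\<ge>N. sqrt (?nB (\<lambda>x. G m x - G n x)) < e" by blast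
  qed
  then obtain g where g: "g \<in> H'" and glim: "(\<lambda>n. sqrt (?nB (\<lambda>x. G n x - g x))) \<longlonglongrightarrow> 0" by blast
  have "f y = g y" for y
  proof (cases "y \<in> S")
    case False
    then show ?thesis using A.vanish[OF f] B.vanish[OF g] by simp
  next
    case y: True
    let ?k = "zero_off S (\<lambda>x. K x y)"
    have "cmod (G n y - g y) \<le> sqrt (?nB (\<lambda>x. G n x - g x)) * sqrt (?nB ?k)" for n
    proof -
      have r: "(\<lambda>x. G n x - g x) \<in> H'" by (intro B.diff_mem g spB G)
      have "(cmod (G n y - g y))\<^sup>2 \<le> ?nB (\<lambda>x. G n x - g x) * ?nB ?k"
        using B.cauchy_schwarz[OF r B.kernel_mem[OF y]] B.reproducing[OF r y] by simp
      from real_le_rsqrt[OF this] show ?thesis by (simp only: real_sqrt_mult)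
    qed
    then have "\<forall>\<^sub>F n in sequentially.
        norm (G n y - g y) \<le> sqrt (?nB (\<lambda>x. G n x - g x)) * sqrt (?nB ?k)"
      by (intro always_eventually allI)
    moreover have "(\<lambda>n. sqrt (?nB (\<lambda>x. G n x - g x)) * sqrt (?nB ?k)) \<longlonglongrightarrow> 0"
      by (rule tendsto_mult_left_zero[OF glim])
    ultimately have "(\<lambda>n. G n y - g y) \<longlonglongrightarrow> 0" by (rule Lim_null_comparison)
    then have "(\<lambda>n. G n y) \<longlonglongrightarrow> g y" by (rule LIM_zero_cancel)
    then show ?thesis using Glim[OF y] LIMSEQ_unique by blast
  qed
  then have "f = g" by auto
  then show "f \<in> H'" using g by simp
qed

theorem reproducing_kernel_space_unique:
  assumes "reproducing_kernel_space S K H ip" and "reproducing_kernel_space S K H' ip'"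
  shows "H = H'"
  using reproducing_kernel_space_subset assms by blast

corollary rkhs_eqI: "reproducing_kernel_space S K H ip \<Longrightarrow> rkhs S K = H"
  unfolding rkhs_def by (rule the_equality) (auto dest: reproducing_kernel_space_unique)


section \<open>Measure-theoretic notions\<close>

definition fin_sets :: "'a measure \<Rightarrow> 'a set set" where
  "fin_sets \<mu> = {A \<in> sets \<mu>. emeasure \<mu> A < \<infinity>}"

definition L2 :: "'a measure \<Rightarrow> ('a \<Rightarrow> complex) set" where
  "L2 \<mu> = {h \<in> borel_measurable \<mu>. integrable \<mu> (\<lambda>x. (cmod (h x))\<^sup>2)}"

definition bounded_quadratic_sums :: "'a measure \<Rightarrow> ('a set \<Rightarrow> complex) \<Rightarrow> bool" where
  "bounded_quadratic_sums \<mu> M \<longleftrightarrow>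
     (\<exists>C::real. \<forall>(N::nat) (A :: nat \<Rightarrow> 'a set).
        (\<forall>n\<in>{1..N}. A n \<in> fin_sets \<mu>) \<longrightarrow> disjoint_family_on A {1..N} \<longrightarrow>
        (\<Sum>n=1..N. if measure \<mu> (A n) = 0 then 0
                  else (cmod (M (A n)))\<^sup>2 / measure \<mu> (A n)) \<le> C)"

definition inter_kernel :: "'a measure \<Rightarrow> 'a set \<Rightarrow> 'a set \<Rightarrow> complex" where
  "inter_kernel \<mu> A B = complex_of_real (measure \<mu> (A \<inter> B))"

end

theory Submission
  imports Defs
begin

text \<open>A finite disjoint family \<open>P\<close> has a step function \<open>h\<^sub>P\<close> with value \<open>M B / \<mu> B\<close> on each
  \<open>B \<in> P\<close>. It is the orthogonal projection onto the span of the indicators of \<open>P\<close> of every square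
  integrable \<open>g\<close> whose integral over each \<open>B \<in> P\<close> is \<open>M B\<close>, and its squared norm is the quadratic
  sum of \<open>P\<close>. Taking for \<open>g\<close> a density of \<open>M\<close> bounds the quadratic sums by the squared norm of the
  density; taking for \<open>g\<close> the step function of a refinement shows that step functions along
  a maximising sequence of families converge, and their limit is a density. The reproducing kernel
  Hilbert space is the image of \<open>L\<^sup>2\<close> under \<open>h \<mapsto> (A \<mapsto> \<integral>\<^sub>A h d\<mu>)\<close>, since this map sends
  the indicator of \<open>B\<close> to the kernel function at \<open>B\<close> and is injective up to null sets.\<close>

section \<open>Square integrable functions\<close>

lemma L2I:
  "h \<in> borel_measurable \<mu> \<Longrightarrow> integrable \<mu> (\<lambda>x. (cmod (h x))\<^sup>2) \<Longrightarrow> h \<in> L2 \<mu>"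
  by (simp add: L2_def)

lemma L2_measurable: "h \<in> L2 \<mu> \<Longrightarrow> h \<in> borel_measurable \<mu>"
  and L2_integrable: "h \<in> L2 \<mu> \<Longrightarrow> integrable \<mu> (\<lambda>x. (cmod (h x))\<^sup>2)"
  by (simp_all add: L2_def)

lemma L2_zero: "(\<lambda>x. 0) \<in> L2 \<mu>"
  by (simp add: L2_def)

lemma L2_scale:
  assumes "f \<in> L2 \<mu>" shows "(\<lambda>x. c * f x) \<in> L2 \<mu>"
  using assms by (auto simp: L2_def norm_mult power_mult_distrib)

text \<open>Stands in for the Minkowski inequality: the estimates below use squared norms, where the
  factor 2 is harmless.\<close>

lemma cmod_add_square_le: "(cmod (a + b))\<^sup>2 \<le> 2 * (cmod a)\<^sup>2 + 2 * (cmod b)\<^sup>2"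
proof -
  have "(cmod (a + b))\<^sup>2 \<le> (cmod a + cmod b)\<^sup>2"
    by (intro power_mono norm_triangle_ineq) auto
  also have "\<dots> \<le> 2 * (cmod a)\<^sup>2 + 2 * (cmod b)\<^sup>2"
    using sum_squares_bound[of "cmod a" "cmod b"] by (simp add: power2_sum)
  finally show ?thesis .
qed

lemma L2_add:
  assumes "f \<in> L2 \<mu>" "g \<in> L2 \<mu>" shows "(\<lambda>x. f x + g x) \<in> L2 \<mu>"
proof (rule L2I)
  note [measurable] = assms[THEN L2_measurable]
  show "(\<lambda>x. f x + g x) \<in> borel_measurable \<mu>" by measurable
  have "integrable \<mu> (\<lambda>x. 2 * (cmod (f x))\<^sup>2 + 2 * (cmod (g x))\<^sup>2)"
    using assms[THEN L2_integrable] by simp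
  then show "integrable \<mu> (\<lambda>x. (cmod (f x + g x))\<^sup>2)"
    by (rule Bochner_Integration.integrable_bound) (auto simp: cmod_add_square_le)
qed

lemma L2_diff:
  assumes "f \<in> L2 \<mu>" "g \<in> L2 \<mu>" shows "(\<lambda>x. f x - g x) \<in> L2 \<mu>"
  using L2_add[OF assms(1) L2_scale[OF assms(2), of "-1"]] by simp

lemma L2_sum:
  assumes "\<And>i. i \<in> I \<Longrightarrow> f i \<in> L2 \<mu>" shows "(\<lambda>x. \<Sum>i\<in>I. f i x) \<in> L2 \<mu>"
  using assms by (induction I rule: infinite_finite_induct) (auto intro: L2_zero L2_add)

section \<open>Sets of finite measure and their indicators\<close>

lemma fin_setsD:
  assumes "A \<in> fin_sets \<mu>"
  shows "A \<in> sets \<mu>" "emeasure \<mu> A < \<infinity>" "emeasure \<mu> A = ennreal (measure \<mu> A)"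
  using assms by (auto simp: fin_sets_def emeasure_eq_ennreal_measure)

lemma fin_sets_subset:
  "A \<in> fin_sets \<mu> \<Longrightarrow> B \<in> sets \<mu> \<Longrightarrow> B \<subseteq> A \<Longrightarrow> B \<in> fin_sets \<mu>"
  by (auto simp: fin_sets_def intro: le_less_trans[OF emeasure_mono])

lemma fin_sets_empty: "{} \<in> fin_sets \<mu>"
  by (simp add: fin_sets_def)

lemma fin_sets_Un: "A \<in> fin_sets \<mu> \<Longrightarrow> B \<in> fin_sets \<mu> \<Longrightarrow> A \<union> B \<in> fin_sets \<mu>"
  by (auto simp: fin_sets_def intro: le_less_trans[OF emeasure_subadditive])

lemma fin_sets_Union:
  "finite P \<Longrightarrow> P \<subseteq> fin_sets \<mu> \<Longrightarrow> \<Union>P \<in> fin_sets \<mu>"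
  by (induction P rule: finite_induct) (auto intro: fin_sets_empty fin_sets_Un)

lemma fin_sets_Int: "A \<in> fin_sets \<mu> \<Longrightarrow> B \<in> fin_sets \<mu> \<Longrightarrow> A \<inter> B \<in> fin_sets \<mu>"
  by (rule fin_sets_subset[of A]) (auto dest: fin_setsD)

lemma fin_sets_Diff: "A \<in> fin_sets \<mu> \<Longrightarrow> B \<in> fin_sets \<mu> \<Longrightarrow> A - B \<in> fin_sets \<mu>"
  by (rule fin_sets_subset[of A]) (auto dest: fin_setsD)

lemma L2_indicator:
  assumes "A \<in> fin_sets \<mu>" shows "(indicator A :: 'a \<Rightarrow> complex) \<in> L2 \<mu>"
proof (rule L2I)
  note A = fin_setsD[OF assms]
  show "(indicator A :: 'a \<Rightarrow> complex) \<in> borel_measurable \<mu>" using A by auto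
  have "(\<lambda>x. (cmod (indicator A x))\<^sup>2) = (indicator A :: 'a \<Rightarrow> real)"
    by (auto simp: indicator_def)
  then show "integrable \<mu> (\<lambda>x. (cmod (indicator A x))\<^sup>2)" using A by simp
qed

text \<open>Elements of \<open>L2\<close> are functions rather than classes, so this form is only
  positive semidefinite: functions vanishing almost everywhere have norm 0.\<close>

definition L2_inner :: "'a measure \<Rightarrow> ('a \<Rightarrow> complex) \<Rightarrow> ('a \<Rightarrow> complex) \<Rightarrow> complex" where
  "L2_inner \<mu> f g = (LINT x|\<mu>. f x * cnj (g x))"

definition L2_sq :: "'a measure \<Rightarrow> ('a \<Rightarrow> complex) \<Rightarrow> real" where
  "L2_sq \<mu> f = (LINT x|\<mu>. (cmod (f x))\<^sup>2)"

lemma L2_mult_integrable: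
  assumes "f \<in> L2 \<mu>" "g \<in> L2 \<mu>" shows "integrable \<mu> (\<lambda>x. f x * cnj (g x))"
proof (rule Bochner_Integration.integrable_bound)
  note [measurable] = assms[THEN L2_measurable]
  show "integrable \<mu> (\<lambda>x. (cmod (f x))\<^sup>2 + (cmod (g x))\<^sup>2)"
    using assms[THEN L2_integrable] by simp
  have [measurable]: "(\<lambda>x. cnj (g x)) \<in> borel_measurable \<mu>"
    by (rule borel_measurable_continuous_on[OF continuous_on_cnj[OF continuous_on_id]]) measurable
  show "(\<lambda>x. f x * cnj (g x)) \<in> borel_measurable \<mu>" by measurable
  have "cmod a * cmod b \<le> (cmod a)\<^sup>2 + (cmod b)\<^sup>2" for a b
  proof -
    have "0 \<le> cmod a * cmod b" by simp
    then show ?thesis using sum_squares_bound[of "cmod a" "cmod b"] by linarith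
  qed
  then show "AE x in \<mu>. norm (f x * cnj (g x)) \<le> norm ((cmod (f x))\<^sup>2 + (cmod (g x))\<^sup>2)"
    by (auto simp: norm_mult)
qed

lemma L2_inner_add_left:
  "f \<in> L2 \<mu> \<Longrightarrow> g \<in> L2 \<mu> \<Longrightarrow> k \<in> L2 \<mu> \<Longrightarrow>
    L2_inner \<mu> (\<lambda>x. f x + g x) k = L2_inner \<mu> f k + L2_inner \<mu> g k"
  by (simp add: L2_inner_def distrib_right L2_mult_integrable)

lemma L2_inner_diff_left:
  "f \<in> L2 \<mu> \<Longrightarrow> g \<in> L2 \<mu> \<Longrightarrow> k \<in> L2 \<mu> \<Longrightarrow>
    L2_inner \<mu> (\<lambda>x. f x - g x) k = L2_inner \<mu> f k - L2_inner \<mu> g k"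
  by (simp add: L2_inner_def left_diff_distrib L2_mult_integrable)

lemma L2_inner_scale_left: "L2_inner \<mu> (\<lambda>x. c * f x) g = c * L2_inner \<mu> f g"
  by (simp add: L2_inner_def mult.assoc)

lemma L2_inner_commute: "L2_inner \<mu> g f = cnj (L2_inner \<mu> f g)"
  unfolding L2_inner_def by (subst Bochner_Integration.integral_cnj[symmetric]) (simp add: mult.commute)

lemma L2_inner_self: "L2_inner \<mu> f f = of_real (L2_sq \<mu> f)"
  by (simp add: L2_inner_def L2_sq_def complex_norm_square[symmetric] del: of_real_power)

lemma L2_sq_nonneg: "L2_sq \<mu> f \<ge> 0"
  by (simp add: L2_sq_def)

lemma L2_sq_eq_0_iff: "f \<in> L2 \<mu> \<Longrightarrow> L2_sq \<mu> f = 0 \<longleftrightarrow> (AE x in \<mu>. f x = 0)"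
  unfolding L2_sq_def by (subst integral_nonneg_eq_0_iff_AE) (auto simp: L2_integrable)

lemma L2_sq_diff_commute: "L2_sq \<mu> (\<lambda>x. f x - g x) = L2_sq \<mu> (\<lambda>x. g x - f x)"
  by (simp add: L2_sq_def norm_minus_commute)

lemma L2_inner_indicator: "L2_inner \<mu> h (indicator A) = (LINT x:A|\<mu>. h x)"
  unfolding L2_inner_def set_lebesgue_integral_def
  by (rule Bochner_Integration.integral_cong) (auto simp: indicator_def)

lemma L2_sq_add_le:
  assumes "f \<in> L2 \<mu>" "g \<in> L2 \<mu>"
  shows "L2_sq \<mu> (\<lambda>x. f x + g x) \<le> 2 * L2_sq \<mu> f + 2 * L2_sq \<mu> g"
proof -
  have "L2_sq \<mu> (\<lambda>x. f x + g x) \<le> (LINT x|\<mu>. 2 * (cmod (f x))\<^sup>2 + 2 * (cmod (g x))\<^sup>2)"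
    unfolding L2_sq_def
    by (rule integral_mono)
      (use assms in \<open>auto simp: L2_integrable L2_add cmod_add_square_le\<close>)
  also have "\<dots> = 2 * L2_sq \<mu> f + 2 * L2_sq \<mu> g"
    using assms by (simp add: L2_sq_def L2_integrable)
  finally show ?thesis .
qed

lemma nn_integral_L2_sq:
  assumes "f \<in> L2 \<mu>"
  shows "(\<integral>\<^sup>+x. ennreal ((cmod (f x))\<^sup>2) \<partial>\<mu>) = ennreal (L2_sq \<mu> f)"
  unfolding L2_sq_def by (rule nn_integral_eq_integral) (auto simp: L2_integrable assms)

text \<open>The hypothesis has the form that Fatou's lemma delivers, for a function not yet known to
  be square integrable.\<close>

lemma L2_sq_leI:
  assumes [measurable]: "f \<in> borel_measurable \<mu>"
    and le: "(\<integral>\<^sup>+x. ennreal ((cmod (f x))\<^sup>2) \<partial>\<mu>) \<le> ennreal e" and "e \<ge> 0"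
  shows "f \<in> L2 \<mu>" "L2_sq \<mu> f \<le> e"
proof -
  show f: "f \<in> L2 \<mu>"
    by (rule L2I, measurable, rule integrableI_nonneg)
      (use le in \<open>auto intro: le_less_trans[OF _ ennreal_less_top]\<close>)
  show "L2_sq \<mu> f \<le> e" using le assms(3) by (simp add: nn_integral_L2_sq[OF f])
qed

section \<open>Completeness of \<open>L2\<close>\<close>

lemma summable_of_weighted_squares:
  fixes d :: "nat \<Rightarrow> complex"
  assumes "summable (\<lambda>n. 2 ^ n * (cmod (d n))\<^sup>2)"
  shows "summable d"
proof (rule summable_comparison_test')
  show "summable (\<lambda>n. 2 ^ n * (cmod (d n))\<^sup>2 + (1/2) ^ n)"
    by (intro summable_add assms summable_geometric) simp
  fix n :: nat
  \<comment> \<open>Used with a = 2^n: weights with summable reciprocals turn control of weighted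
    squares into absolute summability.\<close>
  have "t \<le> a * t\<^sup>2 + 1 / a" if "t \<ge> 0" "a > 0" for t a :: real
  proof -
    have "0 \<le> (a * t - 1)\<^sup>2" by simp
    then have "2 * a * t \<le> (a * t)\<^sup>2 + 1" by (simp add: power2_diff)
    moreover have "0 \<le> a * t" using that by simp
    ultimately have "a * t \<le> (a * t)\<^sup>2 + 1" by linarith
    then show ?thesis using that by (simp add: field_simps power2_eq_square)
  qed
  from this[of "cmod (d n)" "2 ^ n"]
  show "norm (d n) \<le> 2 ^ n * (cmod (d n))\<^sup>2 + (1/2) ^ n"
    by (simp add: power_one_over)
qed

text \<open>The rate (1/4)^n beats the weights 2^n, so the weighted sum of squared increments has
  finite integral and is finite almost everywhere. There the increments are summable, and they
  telescope.\<close>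

lemma L2_rapidly_Cauchy_AE_convergent:
  assumes F: "\<And>n. F n \<in> L2 \<mu>"
    and d: "\<And>n. L2_sq \<mu> (\<lambda>x. F (Suc n) x - F n x) \<le> (1/4) ^ n"
  shows "AE x in \<mu>. convergent (\<lambda>n. F n x)"
proof -
  note [measurable] = L2_measurable[OF F]
  let ?d = "\<lambda>n x. F (Suc n) x - F n x"
  have "(\<integral>\<^sup>+x. (\<Sum>n. ennreal (2 ^ n * (cmod (?d n x))\<^sup>2)) \<partial>\<mu>)
      = (\<Sum>n. \<integral>\<^sup>+x. ennreal (2 ^ n * (cmod (?d n x))\<^sup>2) \<partial>\<mu>)"
    by (rule nn_integral_suminf) measurable
  also have "\<dots> = (\<Sum>n. ennreal (2 ^ n * L2_sq \<mu> (?d n)))"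
    by (simp add: ennreal_mult' nn_integral_cmult nn_integral_L2_sq[OF L2_diff[OF F F]])
  also have "\<dots> \<le> (\<Sum>n. ennreal ((1/2) ^ n))"
  proof (intro suminf_le ennreal_leI summableI)
    fix n
    have "2 ^ n * L2_sq \<mu> (?d n) \<le> 2 ^ n * (1/4) ^ n"
      by (intro mult_left_mono d) simp
    also have "\<dots> = (1/2::real) ^ n" by (simp flip: power_mult_distrib)
    finally show "2 ^ n * L2_sq \<mu> (?d n) \<le> (1/2) ^ n" .
  qed
  also have "\<dots> < top"
    unfolding less_top[symmetric]
    by (rule ennreal_suminf_neq_top) (auto intro!: summable_geometric)
  finally have "(\<integral>\<^sup>+x. (\<Sum>n. ennreal (2 ^ n * (cmod (?d n x))\<^sup>2)) \<partial>\<mu>) \<noteq> \<infinity>"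
    by simp
  from nn_integral_PInf_AE[OF _ this]
  have "AE x in \<mu>. (\<Sum>n. ennreal (2 ^ n * (cmod (?d n x))\<^sup>2)) \<noteq> \<infinity>" by measurable
  then show ?thesis
  proof eventually_elim
    case (elim x)
    then have "summable (\<lambda>n. 2 ^ n * (cmod (?d n x))\<^sup>2)"
      by (intro summable_suminf_not_top) auto
    then have "summable (\<lambda>n. ?d n x)" by (rule summable_of_weighted_squares)
    then have "convergent (\<lambda>n. \<Sum>k<n. ?d k x)" by (simp add: summable_iff_convergent)
    then have "convergent (\<lambda>n. F n x - F 0 x)"
      by (simp add: sum_lessThan_telescope[of "\<lambda>k. F k x"])
    then show ?case using convergent_add[OF _ convergent_const[of "F 0 x"]] by force
  qed
qed

text \<open>A rapidly Cauchy subsequence has an almost everywhere limit. Fatou's lemma along it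
  bounds the distance of every late term of the full sequence to that limit.\<close>

theorem Riesz_Fischer:
  assumes F: "\<And>n. F n \<in> L2 \<mu>"
    and Cauchy: "\<And>e. e > 0 \<Longrightarrow> \<exists>N. \<forall>m\<ge>N. \<forall>n\<ge>N. L2_sq \<mu> (\<lambda>x. F m x - F n x) < e"
  obtains f where "f \<in> L2 \<mu>" "(\<lambda>n. L2_sq \<mu> (\<lambda>x. F n x - f x)) \<longlonglongrightarrow> 0"
proof -
  note [measurable] = L2_measurable[OF F]
  have "\<exists>N. \<forall>m\<ge>N. \<forall>n\<ge>N. L2_sq \<mu> (\<lambda>x. F m x - F n x) < (1/4) ^ k" for k :: nat
    by (rule Cauchy) simp
  then obtain R where R: "\<And>k m n. m \<ge> R k \<Longrightarrow> n \<ge> R k \<Longrightarrow>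
      L2_sq \<mu> (\<lambda>x. F m x - F n x) < (1/4) ^ k"
    by metis
  \<comment> \<open>The sum makes \<open>r\<close> nondecreasing and at least \<open>R n\<close>;
    the summand \<open>n\<close> makes it tend to infinity.\<close>
  define r where "r n = n + (\<Sum>k\<le>n. R k)" for n
  have rR: "r n \<ge> R n" for n
    unfolding r_def by (rule trans_le_add2) (simp add: member_le_sum)
  have rn: "r n \<ge> n" for n by (simp add: r_def)
  have rSuc: "r (Suc n) \<ge> r n" for n by (simp add: r_def)
  have "L2_sq \<mu> (\<lambda>x. F (r (Suc n)) x - F (r n) x) \<le> (1/4) ^ n" for n
    by (rule less_imp_le[OF R]) (use rR rSuc in \<open>auto intro: order_trans\<close>)
  with F have conv: "AE x in \<mu>. convergent (\<lambda>n. F (r n) x)"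
    by (rule L2_rapidly_Cauchy_AE_convergent)
  \<comment> \<open>At points of divergence the value of \<open>lim\<close> is unspecified, but
    these form a null set.\<close>
  define f where "f x = lim (\<lambda>n. F (r n) x)" for x
  have [measurable]: "f \<in> borel_measurable \<mu>" unfolding f_def by measurable
  have lim: "AE x in \<mu>. (\<lambda>n. F (r n) x) \<longlonglongrightarrow> f x"
    using conv by eventually_elim (simp add: f_def convergent_LIMSEQ_iff)
  \<comment> \<open>A bound on the distances from one term to all late terms passes to the limit; it
    also shows that the difference lies in \<open>L2\<close>, from which \<open>f\<close> itself
    does.\<close>
  have fatou: "(\<lambda>x. F n x - f x) \<in> L2 \<mu>" "L2_sq \<mu> (\<lambda>x. F n x - f x) \<le> e"
    if e: "e > 0" and le: "\<And>m. m \<ge> N \<Longrightarrow> L2_sq \<mu> (\<lambda>x. F n x - F m x) \<le> e" for n N e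
  proof -
    have "(\<integral>\<^sup>+x. ennreal ((cmod (F n x - f x))\<^sup>2) \<partial>\<mu>)
        = (\<integral>\<^sup>+x. liminf (\<lambda>k. ennreal ((cmod (F n x - F (r k) x))\<^sup>2)) \<partial>\<mu>)"
    proof (rule nn_integral_cong_AE, use lim in eventually_elim)
      case (elim x)
      then have "(\<lambda>k. ennreal ((cmod (F n x - F (r k) x))\<^sup>2)) \<longlonglongrightarrow> ennreal ((cmod (F n x - f x))\<^sup>2)"
        by (intro tendsto_ennrealI tendsto_intros)
      then show ?case by (rule lim_imp_Liminf[OF sequentially_bot, symmetric])
    qed
    also have "\<dots> \<le> liminf (\<lambda>k. \<integral>\<^sup>+x. ennreal ((cmod (F n x - F (r k) x))\<^sup>2) \<partial>\<mu>)"
      by (rule nn_integral_liminf) measurable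
    also have "\<dots> = liminf (\<lambda>k. ennreal (L2_sq \<mu> (\<lambda>x. F n x - F (r k) x)))"
      by (simp add: nn_integral_L2_sq L2_diff F)
    also have "\<dots> \<le> ennreal e"
    proof (rule Liminf_le[OF sequentially_bot])
      show "\<forall>\<^sub>F k in sequentially. ennreal (L2_sq \<mu> (\<lambda>x. F n x - F (r k) x)) \<le> ennreal e"
        by (intro eventually_sequentiallyI[of N] ennreal_leI le) (use rn in \<open>auto intro: order_trans\<close>)
    qed
    finally have *: "(\<integral>\<^sup>+x. ennreal ((cmod (F n x - f x))\<^sup>2) \<partial>\<mu>) \<le> ennreal e" .
    have "(\<lambda>x. F n x - f x) \<in> borel_measurable \<mu>" by measurable
    from L2_sq_leI[OF this *] e
    show "(\<lambda>x. F n x - f x) \<in> L2 \<mu>" "L2_sq \<mu> (\<lambda>x. F n x - f x) \<le> e" by simp_all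
  qed
  obtain N where N: "\<forall>m\<ge>N. \<forall>n\<ge>N. L2_sq \<mu> (\<lambda>x. F m x - F n x) < 1"
    using Cauchy[of 1] by auto
  have "(\<lambda>x. F N x - f x) \<in> L2 \<mu>"
    by (rule fatou(1)[of 1 N]) (use N in \<open>auto intro: less_imp_le\<close>)
  from L2_diff[OF F[of N] this] have "f \<in> L2 \<mu>" by simp
  moreover have "(\<lambda>n. L2_sq \<mu> (\<lambda>x. F n x - f x)) \<longlonglongrightarrow> 0"
  proof (rule LIMSEQ_I)
    fix e :: real assume e: "0 < e"
    then obtain N where N: "\<forall>m\<ge>N. \<forall>n\<ge>N. L2_sq \<mu> (\<lambda>x. F m x - F n x) < e / 2"
      using Cauchy[of "e / 2"] by auto
    have "L2_sq \<mu> (\<lambda>x. F n x - f x) \<le> e / 2" if "n \<ge> N" for n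
      by (rule fatou(2)[of _ N]) (use N e that in \<open>auto intro: less_imp_le\<close>)
    then have "\<forall>n\<ge>N. norm (L2_sq \<mu> (\<lambda>x. F n x - f x) - 0) < e"
      using e by (fastforce simp: L2_sq_nonneg)
    then show "\<exists>N. \<forall>n\<ge>N. norm (L2_sq \<mu> (\<lambda>x. F n x - f x) - 0) < e" ..
  qed
  ultimately show thesis by (rule that)
qed


section \<open>Step functions and refinement\<close>

lemma L2_inner_diff_right:
  "f \<in> L2 \<mu> \<Longrightarrow> g \<in> L2 \<mu> \<Longrightarrow> k \<in> L2 \<mu> \<Longrightarrow>
    L2_inner \<mu> k (\<lambda>x. f x - g x) = L2_inner \<mu> k f - L2_inner \<mu> k g"
  using L2_inner_commute[of \<mu> k] by (simp add: L2_inner_diff_left)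

lemma L2_inner_sum_left:
  assumes "\<And>i. i \<in> I \<Longrightarrow> f i \<in> L2 \<mu>" "g \<in> L2 \<mu>"
  shows "L2_inner \<mu> (\<lambda>x. \<Sum>i\<in>I. f i x) g = (\<Sum>i\<in>I. L2_inner \<mu> (f i) g)"
  using assms
  by (simp add: L2_inner_def sum_distrib_right L2_mult_integrable Bochner_Integration.integral_sum)

text \<open>On a set of measure 0 the division yields the coefficient 0, in agreement with the
  convention of the quadratic sum.\<close>

definition step_fun ::
    "'a measure \<Rightarrow> ('a set \<Rightarrow> complex) \<Rightarrow> ('i \<Rightarrow> 'a set) \<Rightarrow> 'i set \<Rightarrow> 'a \<Rightarrow> complex" where
  "step_fun \<mu> M A I =
    (\<lambda>x. \<Sum>i\<in>I. M (A i) / of_real (measure \<mu> (A i)) * indicator (A i) x)"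

text \<open>The arbitrary index set covers both the families indexed by \<open>{1..N}\<close> and
  sets of sets that index themselves through \<open>\<lambda>B. B\<close>.\<close>

definition quadratic_sum ::
    "'a measure \<Rightarrow> ('a set \<Rightarrow> complex) \<Rightarrow> ('i \<Rightarrow> 'a set) \<Rightarrow> 'i set \<Rightarrow> real" where
  "quadratic_sum \<mu> M A I =
    (\<Sum>i\<in>I. if measure \<mu> (A i) = 0 then 0 else (cmod (M (A i)))\<^sup>2 / measure \<mu> (A i))"

lemma L2_step_fun:
  "(\<And>i. i \<in> I \<Longrightarrow> A i \<in> fin_sets \<mu>) \<Longrightarrow> step_fun \<mu> M A I \<in> L2 \<mu>"
  unfolding step_fun_def by (intro L2_sum L2_scale L2_indicator)

lemma L2_inner_step_fun_left:
  assumes "\<And>i. i \<in> I \<Longrightarrow> A i \<in> fin_sets \<mu>" "g \<in> L2 \<mu>"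
  shows "L2_inner \<mu> (step_fun \<mu> M A I) g
    = (\<Sum>i\<in>I. M (A i) / of_real (measure \<mu> (A i)) * L2_inner \<mu> (indicator (A i)) g)"
  using assms unfolding step_fun_def
  by (simp add: L2_inner_sum_left L2_scale L2_indicator L2_inner_scale_left
      del: times_divide_eq_left)

text \<open>The product of an indicator of \<open>A i\<close> with \<open>g\<close> is the conjugate
  of \<open>M (A i)\<close>, which turns each coefficient into a term of the quadratic sum. The
  total is real, so the order of the arguments does not matter.\<close>

lemma L2_inner_step_fun:
  assumes A: "\<And>i. i \<in> I \<Longrightarrow> A i \<in> fin_sets \<mu>" and g: "g \<in> L2 \<mu>"
    and eq: "\<And>i. i \<in> I \<Longrightarrow> (LINT x:A i|\<mu>. g x) = M (A i)"
  shows "L2_inner \<mu> g (step_fun \<mu> M A I) = of_real (quadratic_sum \<mu> M A I)"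
proof -
  have "L2_inner \<mu> (step_fun \<mu> M A I) g
      = (\<Sum>i\<in>I. M (A i) / of_real (measure \<mu> (A i)) * cnj (M (A i)))"
    using A g eq
    by (simp add: L2_inner_step_fun_left L2_inner_commute[of \<mu> "indicator _"] L2_inner_indicator)
  also have "\<dots> = of_real (quadratic_sum \<mu> M A I)"
    unfolding quadratic_sum_def of_real_sum
    by (rule sum.cong)
      (auto simp: complex_norm_square[symmetric] simp del: of_real_power)
  finally show ?thesis using L2_inner_commute[of \<mu> g "step_fun \<mu> M A I"] by simp
qed

lemma set_integral_indicator:
  assumes "A \<in> fin_sets \<mu>" "B \<in> fin_sets \<mu>"
  shows "(LINT x:B|\<mu>. (indicator A x :: complex)) = of_real (measure \<mu> (A \<inter> B))"
proof -
  have "(LINT x:B|\<mu>. (indicator A x :: complex)) = (LINT x|\<mu>. complex_of_real (indicator (A \<inter> B) x))"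
    unfolding set_lebesgue_integral_def
    by (rule Bochner_Integration.integral_cong) (auto simp: indicator_def)
  also have "\<dots> = of_real (measure \<mu> (A \<inter> B))"
    using fin_setsD[OF fin_sets_Int[OF assms]]
    by (simp only: integral_complex_of_real) simp
  finally show ?thesis .
qed

text \<open>Disjointness leaves only the term of \<open>j\<close>, in which the measure cancels. If
  that measure is 0 the term vanishes, and \<open>null\<close> makes this the right value.\<close>

lemma set_integral_step_fun:
  assumes A: "\<And>i. i \<in> I \<Longrightarrow> A i \<in> fin_sets \<mu>" and I: "finite I" "disjoint_family_on A I"
    and j: "j \<in> I" and null: "measure \<mu> (A j) = 0 \<Longrightarrow> M (A j) = 0"
  shows "(LINT x:A j|\<mu>. step_fun \<mu> M A I x) = M (A j)"
proof -
  have "(LINT x:A j|\<mu>. step_fun \<mu> M A I x)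
      = (\<Sum>i\<in>I. M (A i) / of_real (measure \<mu> (A i)) * of_real (measure \<mu> (A i \<inter> A j)))"
    unfolding L2_inner_indicator[symmetric]
    using A j
    by (simp add: L2_inner_step_fun_left L2_indicator, simp add: L2_inner_indicator set_integral_indicator)
  also have "\<dots> = (\<Sum>i\<in>I. if i = j then M (A j) else 0)"
  proof (rule sum.cong)
    fix i assume i: "i \<in> I"
    then have "i \<noteq> j \<Longrightarrow> A i \<inter> A j = {}"
      using I(2) j by (auto simp: disjoint_family_on_def)
    then show "M (A i) / of_real (measure \<mu> (A i)) * of_real (measure \<mu> (A i \<inter> A j))
        = (if i = j then M (A j) else 0)"
      using null by auto
  qed simp
  also have "\<dots> = M (A j)" using I(1) j by simp
  finally show ?thesis .
qed

lemma set_integral_null: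
  assumes [measurable]: "h \<in> borel_measurable \<mu>" "A \<in> sets \<mu>" and null: "emeasure \<mu> A = 0"
  shows "(LINT x:A|\<mu>. h x :: complex) = 0"
proof -
  have "AE x in \<mu>. x \<notin> A" using assms by (intro AE_not_in) (simp add: null_sets_def)
  then have "(LINT x:A|\<mu>. h x) = (LINT x|\<mu>. 0)"
    unfolding set_lebesgue_integral_def
    by (intro integral_cong_AE) (measurable, auto)
  then show ?thesis by simp
qed

text \<open>Pythagoras: \<open>g\<close> and the step function have the same integrals over each
  \<open>A i\<close>, so the product of either with the step function is the quadratic sum.\<close>

lemma L2_sq_diff_step_fun:
  assumes A: "\<And>i. i \<in> I \<Longrightarrow> A i \<in> fin_sets \<mu>" and I: "finite I" "disjoint_family_on A I"
    and g: "g \<in> L2 \<mu>" and eq: "\<And>i. i \<in> I \<Longrightarrow> (LINT x:A i|\<mu>. g x) = M (A i)"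
  shows "L2_sq \<mu> (\<lambda>x. g x - step_fun \<mu> M A I x) = L2_sq \<mu> g - quadratic_sum \<mu> M A I"
proof -
  define s where "s = step_fun \<mu> M A I"
  have s: "s \<in> L2 \<mu>" unfolding s_def using A by (rule L2_step_fun)
  have null: "M (A i) = 0" if "i \<in> I" "measure \<mu> (A i) = 0" for i
    using set_integral_null[OF L2_measurable[OF g], of "A i"] fin_setsD[OF A[OF that(1)]] that eq by simp
  have gs: "L2_inner \<mu> g s = of_real (quadratic_sum \<mu> M A I)"
    unfolding s_def using A g eq by (rule L2_inner_step_fun)
  have ss: "L2_inner \<mu> s s = of_real (quadratic_sum \<mu> M A I)"
    using s unfolding s_def
    by (intro L2_inner_step_fun set_integral_step_fun A I null)
  have sg: "L2_inner \<mu> s g = of_real (quadratic_sum \<mu> M A I)"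
    using gs L2_inner_commute[of \<mu> s g] by simp
  have "L2_inner \<mu> (\<lambda>x. g x - s x) (\<lambda>x. g x - s x)
      = L2_inner \<mu> g g - of_real (quadratic_sum \<mu> M A I)"
    using g s gs ss sg by (simp add: L2_inner_diff_left L2_inner_diff_right L2_diff)
  then have "complex_of_real (L2_sq \<mu> (\<lambda>x. g x - s x))
      = of_real (L2_sq \<mu> g - quadratic_sum \<mu> M A I)"
    by (simp add: L2_inner_self)
  then show ?thesis unfolding s_def of_real_eq_iff .
qed

text \<open>Bessel's inequality: the squared distance to the projection is nonnegative.\<close>

lemma quadratic_sum_le_L2_sq:
  assumes "\<And>i. i \<in> I \<Longrightarrow> A i \<in> fin_sets \<mu>" "finite I" "disjoint_family_on A I"
    and "g \<in> L2 \<mu>" "\<And>i. i \<in> I \<Longrightarrow> (LINT x:A i|\<mu>. g x) = M (A i)"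
  shows "quadratic_sum \<mu> M A I \<le> L2_sq \<mu> g"
  using L2_sq_diff_step_fun[of I A \<mu> g M, OF assms] L2_sq_nonneg[of \<mu>] by (metis diff_ge_0_iff_ge)

text \<open>Cauchy-Schwarz against an indicator, read off from Bessel's inequality for a one-element
  family and the set function given by the integrals of \<open>g\<close> itself.\<close>

lemma set_integral_square_le:
  assumes g: "g \<in> L2 \<mu>" and A: "A \<in> fin_sets \<mu>"
  shows "(cmod (LINT x:A|\<mu>. g x))\<^sup>2 \<le> measure \<mu> A * L2_sq \<mu> g"
proof (cases "measure \<mu> A = 0")
  case True
  then show ?thesis using set_integral_null[OF L2_measurable[OF g], of A] fin_setsD[OF A] by simp
next
  case False
  then have "measure \<mu> A > 0" by (simp add: zero_less_measure_iff)
  moreover have "quadratic_sum \<mu> (\<lambda>A. LINT x:A|\<mu>. g x) (\<lambda>_. A) {()} \<le> L2_sq \<mu> g"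
    by (rule quadratic_sum_le_L2_sq) (use A g in \<open>auto simp: disjoint_family_on_def\<close>)
  ultimately show ?thesis by (simp add: quadratic_sum_def field_simps)
qed

section \<open>Packings and their common refinements\<close>

definition packings :: "'a measure \<Rightarrow> 'a set set set" where
  "packings \<mu> = {P. finite P \<and> disjoint P \<and> P \<subseteq> fin_sets \<mu>}"

text \<open>A packing \<open>Q\<close> counts as a refinement of \<open>P\<close> when it resolves
  every member of \<open>P\<close>; it may have further members outside the union of
  \<open>P\<close>.\<close>

definition resolves :: "'a set set \<Rightarrow> 'a set \<Rightarrow> bool" where
  "resolves Q A \<longleftrightarrow> A = \<Union>{B \<in> Q. B \<subseteq> A}"

lemma packingsD:
  assumes "P \<in> packings \<mu>"
  shows "finite P" "disjoint P" "\<And>B. B \<in> P \<Longrightarrow> B \<in> fin_sets \<mu>" "disjoint_family_on (\<lambda>B. B) P"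
  using assms by (auto simp: packings_def disjoint_family_on_def disjoint_def)

lemma resolves_iff: "resolves Q A \<longleftrightarrow> (\<forall>x\<in>A. \<exists>B\<in>Q. x \<in> B \<and> B \<subseteq> A)"
  by (auto simp: resolves_def)

text \<open>Each member of \<open>Q\<close> is cut along \<open>E\<close>, and the uncovered rest of
  \<open>E\<close> is added as one more piece. Pieces of a set inside \<open>A\<close> stay inside
  \<open>A\<close>, so nothing already resolved is lost.\<close>

lemma packings_refine_one:
  assumes Q: "Q \<in> packings \<mu>" and E: "E \<in> fin_sets \<mu>"
  obtains Q' where "Q' \<in> packings \<mu>" "resolves Q' E" "\<And>A. resolves Q A \<Longrightarrow> resolves Q' A"
proof
  let ?Q = "(\<lambda>B. B \<inter> E) ` Q \<union> (\<lambda>B. B - E) ` Q \<union> {E - \<Union>Q}"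
  note D = packingsD[OF Q]
  have "disjoint ?Q"
    using D(2) unfolding disjoint_def by blast
  moreover have "?Q \<subseteq> fin_sets \<mu>"
    using D(1,3) E by (auto intro!: fin_sets_Int fin_sets_Diff fin_sets_Union)
  ultimately show "?Q \<in> packings \<mu>" using D(1) by (simp add: packings_def)
  show "resolves ?Q E"
    unfolding resolves_iff
  proof
    fix x assume x: "x \<in> E"
    show "\<exists>B\<in>?Q. x \<in> B \<and> B \<subseteq> E"
    proof (cases "x \<in> \<Union>Q")
      case True
      then obtain B where "B \<in> Q" "x \<in> B" by auto
      then show ?thesis using x by (intro bexI[of _ "B \<inter> E"]) auto
    next
      case False
      then show ?thesis using x by (intro bexI[of _ "E - \<Union>Q"]) auto
    qed
  qed
  fix A assume "resolves Q A"
  show "resolves ?Q A"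
    unfolding resolves_iff
  proof
    fix x assume "x \<in> A"
    then obtain B where B: "B \<in> Q" "x \<in> B" "B \<subseteq> A"
      using \<open>resolves Q A\<close> by (auto simp: resolves_iff)
    show "\<exists>B\<in>?Q. x \<in> B \<and> B \<subseteq> A"
    proof (cases "x \<in> E")
      case True
      then show ?thesis using B by (intro bexI[of _ "B \<inter> E"]) auto
    next
      case False
      then show ?thesis using B by (intro bexI[of _ "B - E"]) auto
    qed
  qed
qed

text \<open>The given sets may overlap; for the union of two packings this yields a common
  refinement.\<close>

lemma packings_refine:
  assumes "finite \<E>" "\<E> \<subseteq> fin_sets \<mu>"
  shows "\<exists>Q\<in>packings \<mu>. \<forall>E\<in>\<E>. resolves Q E"
  using assms
proof induction
  case empty
  have "{} \<in> packings \<mu>" by (simp add: packings_def)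
  then show ?case by auto
next
  case (insert E \<E>)
  then obtain Q where Q: "Q \<in> packings \<mu>" "\<forall>E\<in>\<E>. resolves Q E" by auto
  obtain Q' where "Q' \<in> packings \<mu>" "resolves Q' E" "\<And>A. resolves Q A \<Longrightarrow> resolves Q' A"
    using packings_refine_one[OF Q(1)] insert.prems by (metis insert_subset)
  then show ?case using Q(2) by (intro bexI[of _ Q']) auto
qed

text \<open>The locale is applied both to the given \<open>M\<close> and to the integrals of a step
  function, so that the two can be compared on resolved sets.\<close>

locale additive_set_function =
  fixes \<mu> :: "'a measure" and M :: "'a set \<Rightarrow> complex"
  assumes additive: "\<And>A B. A \<in> fin_sets \<mu> \<Longrightarrow> B \<in> fin_sets \<mu> \<Longrightarrow> A \<inter> B = {} \<Longrightarrow>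
      M (A \<union> B) = M A + M B"
    and null: "\<And>A. A \<in> fin_sets \<mu> \<Longrightarrow> emeasure \<mu> A = 0 \<Longrightarrow> M A = 0"
begin

lemma null_measure: "A \<in> fin_sets \<mu> \<Longrightarrow> measure \<mu> A = 0 \<Longrightarrow> M A = 0"
  using null fin_setsD(3) by (metis ennreal_0)

lemma Union_packing:
  assumes "P \<in> packings \<mu>" shows "M (\<Union>P) = (\<Sum>B\<in>P. M B)"
  using packingsD(1-3)[OF assms]
proof (induction P rule: finite_induct)
  case empty
  show ?case using null[OF fin_sets_empty] by simp
next
  case (insert A P)
  have "A \<inter> \<Union>P = {}"
    using insert.prems(1) insert.hyps(2) by (auto simp: disjoint_def)
  moreover have "disjoint P" using insert.prems(1) by (auto simp: disjoint_def)
  moreover have "\<Union>P \<in> fin_sets \<mu>"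
    using insert.hyps(1) insert.prems(2) by (intro fin_sets_Union) auto
  ultimately show ?case using insert by (simp add: additive)
qed

lemma resolved:
  assumes Q: "Q \<in> packings \<mu>" and "resolves Q E"
  shows "M E = (\<Sum>B | B \<in> Q \<and> B \<subseteq> E. M B)"
proof -
  have "{B \<in> Q. B \<subseteq> E} \<in> packings \<mu>"
    using packingsD[OF Q] by (auto simp: packings_def disjoint_def)
  from Union_packing[OF this] show ?thesis using assms(2) by (simp add: resolves_def)
qed

end

lemma additive_set_function_set_integral:
  assumes g: "g \<in> L2 \<mu>"
  shows "additive_set_function \<mu> (\<lambda>A. LINT x:A|\<mu>. g x)"
proof
  fix A B assume AB: "A \<in> fin_sets \<mu>" "B \<in> fin_sets \<mu>" "A \<inter> B = {}"
  \<comment> \<open>A square integrable function need not be integrable, but its product with an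
    indicator in \<open>L2\<close> is.\<close>
  have "set_integrable \<mu> A g" if "A \<in> fin_sets \<mu>" for A
  proof -
    have "(\<lambda>x. g x * cnj (indicator A x)) = (\<lambda>x. indicator A x *\<^sub>R g x)"
      by (auto simp: indicator_def)
    then show ?thesis
      using L2_mult_integrable[OF g L2_indicator[OF that]] by (simp add: set_integrable_def)
  qed
  with AB show "(LINT x:A \<union> B|\<mu>. g x) = (LINT x:A|\<mu>. g x) + (LINT x:B|\<mu>. g x)"
    by (intro set_integral_Un) auto
qed (auto intro: set_integral_null L2_measurable g fin_setsD)

section \<open>Existence of a square integrable density\<close>

context additive_set_function
begin

abbreviation "step P \<equiv> step_fun \<mu> M (\<lambda>B. B) P"
abbreviation "qsum P \<equiv> quadratic_sum \<mu> M (\<lambda>B. B) P"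

lemma L2_step: "P \<in> packings \<mu> \<Longrightarrow> step P \<in> L2 \<mu>"
  by (rule L2_step_fun) (rule packingsD)

text \<open>Both sides are additive in the set and agree on the members of \<open>Q\<close>, hence
  on any union of members.\<close>

lemma set_integral_step_resolved:
  assumes Q: "Q \<in> packings \<mu>" and E: "resolves Q E"
  shows "(LINT x:E|\<mu>. step Q x) = M E"
proof -
  interpret S: additive_set_function \<mu> "\<lambda>A. LINT x:A|\<mu>. step Q x"
    by (rule additive_set_function_set_integral[OF L2_step[OF Q]])
  have "(LINT x:B|\<mu>. step Q x) = M B" if "B \<in> Q" for B
    using packingsD[OF Q] that by (intro set_integral_step_fun) (auto intro: null_measure)
  then show ?thesis using S.resolved[OF Q E] resolved[OF Q E] by simp
qed

text \<open>The finer step function has integral \<open>M A\<close> over each \<open>A\<close> in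
  \<open>P\<close>, so it can serve as \<open>g\<close> in the Pythagorean identity. In particular,
  refinement never decreases \<open>qsum\<close>.\<close>

lemma L2_sq_step_refinement:
  assumes Q: "Q \<in> packings \<mu>" and P: "P \<in> packings \<mu>" and QP: "\<And>A. A \<in> P \<Longrightarrow> resolves Q A"
  shows "L2_sq \<mu> (\<lambda>x. step Q x - step P x) = qsum Q - qsum P"
proof -
  have "L2_sq \<mu> (step Q) = qsum Q"
  proof -
    have "complex_of_real (L2_sq \<mu> (step Q)) = of_real (qsum Q)"
      unfolding L2_inner_self[symmetric]
      using packingsD[OF Q]
      by (intro L2_inner_step_fun set_integral_step_fun L2_step[OF Q]) (auto intro: null_measure)
    then show ?thesis by (simp only: of_real_eq_iff)
  qed
  moreover have "L2_sq \<mu> (\<lambda>x. step Q x - step P x) = L2_sq \<mu> (step Q) - qsum P"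
    using packingsD[OF P]
    by (intro L2_sq_diff_step_fun L2_step[OF Q] set_integral_step_resolved[OF Q QP])
  ultimately show ?thesis by simp
qed

text \<open>Along a sequence of packings maximising \<open>qsum\<close>, the step functions form a Cauchy sequence:
  by Pythagoras, passing to a finer packing moves the step function by the increase of \<open>qsum\<close>.\<close>

lemma density_exists:
  assumes C: "\<And>P. P \<in> packings \<mu> \<Longrightarrow> qsum P \<le> C"
  shows "\<exists>h\<in>L2 \<mu>. \<forall>A\<in>fin_sets \<mu>. M A = (LINT x:A|\<mu>. h x)"
proof -
  define s where "s = Sup (qsum ` packings \<mu>)"
  have bdd: "bdd_above (qsum ` packings \<mu>)" using C by (intro bdd_aboveI2)
  have ne: "packings \<mu> \<noteq> {}" using packings_refine[of "{}" \<mu>] by auto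
  have le_s: "qsum P \<le> s" if "P \<in> packings \<mu>" for P
    unfolding s_def using that bdd by (intro cSup_upper) auto
  have "\<exists>P\<in>packings \<mu>. s - inverse (Suc n) < qsum P" for n
    using less_cSup_iff[of "qsum ` packings \<mu>" "s - inverse (Suc n)"] bdd ne by (simp add: s_def)
  then obtain P where P: "\<And>n. P n \<in> packings \<mu>" and Ps: "\<And>n. s - inverse (Suc n) < qsum (P n)"
    by metis
  \<comment> \<open>\<open>qsum (P n)\<close> is within \<open>inverse (Suc n)\<close> of the
    supremum, so no refinement can gain more than that.\<close>
  have near: "L2_sq \<mu> (\<lambda>x. step Q x - step (P n) x) \<le> inverse (Suc n)"
    if "Q \<in> packings \<mu>" "\<And>A. A \<in> P n \<Longrightarrow> resolves Q A" for Q n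
    using L2_sq_step_refinement[OF that(1) P that(2)] le_s[OF that(1)] Ps[of n] by simp
  obtain h where h: "h \<in> L2 \<mu>" and lim: "(\<lambda>n. L2_sq \<mu> (\<lambda>x. step (P n) x - h x)) \<longlonglongrightarrow> 0"
  proof (rule Riesz_Fischer[of "\<lambda>n. step (P n)" \<mu>])
    show "step (P n) \<in> L2 \<mu>" for n by (rule L2_step[OF P])
    fix e :: real assume e: "e > 0"
    then obtain N where N: "inverse (Suc N) < e / 4"
      using reals_Archimedean[of "e / 4"] by auto
    have "L2_sq \<mu> (\<lambda>x. step (P m) x - step (P n) x) < e" if "m \<ge> N" "n \<ge> N" for m n
    proof -
      obtain Q where Q: "Q \<in> packings \<mu>" "\<And>A. A \<in> P m \<union> P n \<Longrightarrow> resolves Q A"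
        using packings_refine[of "P m \<union> P n" \<mu>] packingsD[OF P] by (metis Un_iff finite_UnI subsetI)
      \<comment> \<open>The two step functions are compared through the step function of a common
        refinement, to which both are near.\<close>
      have "L2_sq \<mu> (\<lambda>x. (step (P m) x - step Q x) + (step Q x - step (P n) x))
          \<le> 2 * L2_sq \<mu> (\<lambda>x. step (P m) x - step Q x) + 2 * L2_sq \<mu> (\<lambda>x. step Q x - step (P n) x)"
        by (intro L2_sq_add_le L2_diff L2_step P Q)
      also have "\<dots> \<le> 2 * inverse (Suc m) + 2 * inverse (Suc n)"
        unfolding L2_sq_diff_commute[of \<mu> "step (P m)"]
        by (intro add_mono mult_left_mono near Q) auto
      also have "\<dots> \<le> 2 * inverse (Suc N) + 2 * inverse (Suc N)"
        using that by (intro add_mono mult_left_mono le_imp_inverse_le) auto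
      also have "\<dots> < e" using N by simp
      finally show ?thesis by simp
    qed
    then show "\<exists>N. \<forall>m\<ge>N. \<forall>n\<ge>N. L2_sq \<mu> (\<lambda>x. step (P m) x - step (P n) x) < e" by blast
  qed
  have "M A = (LINT x:A|\<mu>. h x)" if A: "A \<in> fin_sets \<mu>" for A
  proof -
    \<comment> \<open>\<open>P n\<close> need not resolve \<open>A\<close>, but a refinement
      \<open>Q\<close> does: its step function has integral exactly \<open>M A\<close> over
      \<open>A\<close> and is still close to \<open>h\<close>.\<close>
    have bound: "(cmod (M A - (LINT x:A|\<mu>. h x)))\<^sup>2
        \<le> measure \<mu> A * (2 * inverse (Suc n) + 2 * L2_sq \<mu> (\<lambda>x. step (P n) x - h x))" for n
    proof -
      obtain Q where Q: "Q \<in> packings \<mu>" "\<And>B. B \<in> insert A (P n) \<Longrightarrow> resolves Q B"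
        using packings_refine[of "insert A (P n)" \<mu>] packingsD[OF P] A
        by (metis finite_insert insert_iff subsetI)
      have "M A - (LINT x:A|\<mu>. h x) = (LINT x:A|\<mu>. step Q x - h x)"
        using set_integral_step_resolved[OF Q(1), of A] Q(2)
        by (simp add: L2_inner_indicator[symmetric] L2_inner_diff_left L2_step Q h L2_indicator A)
      also have "(cmod \<dots>)\<^sup>2 \<le> measure \<mu> A * L2_sq \<mu> (\<lambda>x. step Q x - h x)"
        by (intro set_integral_square_le L2_diff L2_step Q h A)
      also have "\<dots> \<le> measure \<mu> A * (2 * inverse (Suc n) + 2 * L2_sq \<mu> (\<lambda>x. step (P n) x - h x))"
      proof (rule mult_left_mono)
        have "L2_sq \<mu> (\<lambda>x. (step Q x - step (P n) x) + (step (P n) x - h x))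
            \<le> 2 * L2_sq \<mu> (\<lambda>x. step Q x - step (P n) x) + 2 * L2_sq \<mu> (\<lambda>x. step (P n) x - h x)"
          by (intro L2_sq_add_le L2_diff L2_step P Q h)
        also have "\<dots> \<le> 2 * inverse (Suc n) + 2 * L2_sq \<mu> (\<lambda>x. step (P n) x - h x)"
          by (intro add_mono mult_left_mono near Q) auto
        finally show "L2_sq \<mu> (\<lambda>x. step Q x - h x)
            \<le> 2 * inverse (Suc n) + 2 * L2_sq \<mu> (\<lambda>x. step (P n) x - h x)" by simp
      qed simp
      finally show ?thesis .
    qed
    have "(\<lambda>n. measure \<mu> A * (2 * inverse (Suc n) + 2 * L2_sq \<mu> (\<lambda>x. step (P n) x - h x)))
        \<longlonglongrightarrow> measure \<mu> A * (2 * 0 + 2 * 0)"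
      by (intro tendsto_intros LIMSEQ_inverse_real_of_nat lim)
    \<comment> \<open>The left side of \<open>bound\<close> does not depend on \<open>n\<close>, so
      it is at most the limit 0.\<close>
    then have "(cmod (M A - (LINT x:A|\<mu>. h x)))\<^sup>2 \<le> measure \<mu> A * (2 * 0 + 2 * 0)"
      by (rule LIMSEQ_le_const) (use bound in blast)
    then show ?thesis by simp
  qed
  with h show ?thesis by blast
qed

lemma bounded_quadratic_sums_iff:
  "bounded_quadratic_sums \<mu> M \<longleftrightarrow> (\<exists>h\<in>L2 \<mu>. \<forall>A\<in>fin_sets \<mu>. M A = (LINT x:A|\<mu>. h x))"
proof
  assume "\<exists>h\<in>L2 \<mu>. \<forall>A\<in>fin_sets \<mu>. M A = (LINT x:A|\<mu>. h x)"
  then obtain h where h: "h \<in> L2 \<mu>" "\<And>A. A \<in> fin_sets \<mu> \<Longrightarrow> (LINT x:A|\<mu>. h x) = M A" by auto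
  have "quadratic_sum \<mu> M A {1..N} \<le> L2_sq \<mu> h"
    if "\<forall>n\<in>{1..N}. A n \<in> fin_sets \<mu>" "disjoint_family_on A {1..N}" for N :: nat and A
    using that by (intro quadratic_sum_le_L2_sq h) auto
  then show "bounded_quadratic_sums \<mu> M"
    unfolding bounded_quadratic_sums_def quadratic_sum_def by blast
next
  assume "bounded_quadratic_sums \<mu> M"
  then obtain C where C: "quadratic_sum \<mu> M A {1..N} \<le> C"
    if "\<forall>n\<in>{1..N}. A n \<in> fin_sets \<mu>" "disjoint_family_on A {1..N}" for N :: nat and A
    unfolding bounded_quadratic_sums_def quadratic_sum_def by blast
  show "\<exists>h\<in>L2 \<mu>. \<forall>A\<in>fin_sets \<mu>. M A = (LINT x:A|\<mu>. h x)"
  proof (rule density_exists)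
    fix P assume "P \<in> packings \<mu>"
    note P = packingsD[OF this]
    \<comment> \<open>Counting from 1 matches the index set of the hypothesis; injectivity gives
      distinct indices distinct, hence disjoint, members.\<close>
    obtain A where A: "bij_betw A {1..card P} P"
      using ex_bij_betw_nat_finite_1[OF P(1)] by blast
    then have inj: "inj_on A {1..card P}" and im: "A ` {1..card P} = P"
      by (auto simp: bij_betw_def)
    have "quadratic_sum \<mu> M A {1..card P} \<le> C"
    proof (rule C)
      show "\<forall>n\<in>{1..card P}. A n \<in> fin_sets \<mu>" using im P(3) by blast
      show "disjoint_family_on A {1..card P}"
        using disjoint_image_disjoint_family_on[OF _ inj] P(2) im by metis
    qed
    then show "qsum P \<le> C"
      unfolding quadratic_sum_def
      by (simp only: sum.reindex_bij_betw[OF A,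
            of "\<lambda>B. if measure \<mu> B = 0 then 0 else (cmod (M B))\<^sup>2 / measure \<mu> B"])
  qed
qed

end

section \<open>The reproducing kernel Hilbert space\<close>

definition L2_transform :: "'a measure \<Rightarrow> ('a \<Rightarrow> complex) \<Rightarrow> 'a set \<Rightarrow> complex" where
  "L2_transform \<mu> h = zero_off (fin_sets \<mu>) (\<lambda>A. LINT x:A|\<mu>. h x)"

text \<open>Written as an inner product with indicators, the transform inherits linearity from
  \<open>L2_inner\<close>.\<close>

lemma L2_transform_eq:
  "L2_transform \<mu> h = (\<lambda>A. if A \<in> fin_sets \<mu> then L2_inner \<mu> h (indicator A) else 0)"
  by (auto simp: L2_transform_def zero_off_def L2_inner_indicator)

lemma L2_transform_add:
  "f \<in> L2 \<mu> \<Longrightarrow> g \<in> L2 \<mu> \<Longrightarrow>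
    (\<lambda>A. L2_transform \<mu> f A + L2_transform \<mu> g A) = L2_transform \<mu> (\<lambda>x. f x + g x)"
  by (auto simp: L2_transform_eq L2_inner_add_left L2_indicator)

lemma L2_transform_diff:
  "f \<in> L2 \<mu> \<Longrightarrow> g \<in> L2 \<mu> \<Longrightarrow>
    (\<lambda>A. L2_transform \<mu> f A - L2_transform \<mu> g A) = L2_transform \<mu> (\<lambda>x. f x - g x)"
  by (auto simp: L2_transform_eq L2_inner_diff_left L2_indicator)

lemma L2_transform_scale:
  "(\<lambda>A. c * L2_transform \<mu> f A) = L2_transform \<mu> (\<lambda>x. c * f x)"
  by (auto simp: L2_transform_eq L2_inner_scale_left)

lemma L2_transform_zero: "L2_transform \<mu> (\<lambda>x. 0) = (\<lambda>A. 0)"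
  by (auto simp: L2_transform_eq L2_inner_def)

text \<open>Source of the reproducing property: pairing \<open>h\<close> with the indicator of
  \<open>B\<close> evaluates the transform of \<open>h\<close> at \<open>B\<close>.\<close>

lemma L2_transform_indicator:
  assumes "B \<in> fin_sets \<mu>"
  shows "zero_off (fin_sets \<mu>) (\<lambda>A. inter_kernel \<mu> A B) = L2_transform \<mu> (indicator B)"
  using assms
  by (auto simp: L2_transform_def zero_off_def set_integral_indicator inter_kernel_def Int_commute)

lemma L2_inner_cong_AE:
  assumes "f \<in> L2 \<mu>" "f' \<in> L2 \<mu>" "g \<in> L2 \<mu>" "g' \<in> L2 \<mu>"
    and "AE x in \<mu>. f x = f' x" "AE x in \<mu>. g x = g' x"
  shows "L2_inner \<mu> f g = L2_inner \<mu> f' g'"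
  unfolding L2_inner_def
  by (rule integral_cong_AE)
    (use assms in \<open>auto intro: borel_measurable_integrable L2_mult_integrable\<close>)

section \<open>Injectivity up to null sets and the transported Hilbert space structure\<close>

context sigma_finite_measure
begin

text \<open>In this context \<open>M\<close> is the measure. Sigma-finiteness covers the space by
  countably many sets of finite measure; on each of them all integrals of \<open>h\<close> vanish,
  so \<open>h\<close> does almost everywhere.\<close>

lemma L2_transform_eq_0_imp_AE:
  assumes h: "h \<in> L2 M" and zero: "L2_transform M h = (\<lambda>A. 0)"
  shows "AE x in M. h x = 0"
proof -
  obtain E :: "nat \<Rightarrow> 'a set" where E: "range E \<subseteq> sets M" "(\<Union>i. E i) = space M" "\<And>i. emeasure M (E i) \<noteq> \<infinity>"
    using sigma_finite by blast
  have Ef: "E i \<in> fin_sets M" for i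
    using E(1) E(3)[of i] by (auto simp: fin_sets_def less_top)
  \<comment> \<open>Cutting \<open>h\<close> off to \<open>E i\<close> makes it integrable; the
    conjugation only fits the form of \<open>L2_mult_integrable\<close>.\<close>
  have "AE x in M. h x * cnj (indicator (E i) x) = 0" for i
  proof (rule density_zero)
    show "integrable M (\<lambda>x. h x * cnj (indicator (E i) x))"
      by (intro L2_mult_integrable h L2_indicator Ef)
    fix A assume "A \<in> sets M"
    then have "A \<inter> E i \<in> fin_sets M" using Ef[of i] by (intro fin_sets_subset[OF Ef[of i]]) (auto dest: fin_setsD)
    then have "(LINT x:A \<inter> E i|M. h x) = 0"
      using fun_cong[OF zero, of "A \<inter> E i"] by (simp add: L2_transform_def zero_off_def)
    moreover have "(LINT x:A|M. h x * cnj (indicator (E i) x)) = (LINT x:A \<inter> E i|M. h x)"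
      unfolding set_lebesgue_integral_def
      by (rule Bochner_Integration.integral_cong) (auto simp: indicator_def)
    ultimately show "(LINT x:A|M. h x * cnj (indicator (E i) x)) = 0" by simp
  qed
  then have "AE x in M. \<forall>i. h x * cnj (indicator (E i) x) = 0"
    by (subst AE_all_countable) blast
  then show ?thesis
    using AE_space
  proof eventually_elim
    case (elim x)
    then obtain i where "x \<in> E i" using E(2) by auto
    then show ?case using elim(1) by (auto dest: spec[of _ i])
  qed
qed

lemma L2_transform_eq_imp_AE:
  assumes "f \<in> L2 M" "g \<in> L2 M" "L2_transform M f = L2_transform M g"
  shows "AE x in M. f x = g x"
  using L2_transform_eq_0_imp_AE[OF L2_diff[OF assms(1,2)]] L2_transform_diff[OF assms(1,2)] assms(3)
  by simp

text \<open>The preimage is determined only up to null sets, so a representative is chosen; inner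
  products do not see the choice.\<close>

definition L2_preimage :: "('a set \<Rightarrow> complex) \<Rightarrow> 'a \<Rightarrow> complex" where
  "L2_preimage f = (SOME h. h \<in> L2 M \<and> L2_transform M h = f)"

lemma L2_preimage:
  assumes "h \<in> L2 M"
  shows "L2_preimage (L2_transform M h) \<in> L2 M"
    "AE x in M. L2_preimage (L2_transform M h) x = h x"
proof -
  have *: "L2_preimage (L2_transform M h) \<in> L2 M \<and>
      L2_transform M (L2_preimage (L2_transform M h)) = L2_transform M h"
    unfolding L2_preimage_def by (rule someI[of _ h]) (use assms in simp)
  then show "L2_preimage (L2_transform M h) \<in> L2 M" ..
  show "AE x in M. L2_preimage (L2_transform M h) x = h x"
    by (rule L2_transform_eq_imp_AE) (use * assms in auto)
qed

definition transform_inner :: "('a set \<Rightarrow> complex) \<Rightarrow> ('a set \<Rightarrow> complex) \<Rightarrow> complex" where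
  "transform_inner f g = L2_inner M (L2_preimage f) (L2_preimage g)"

lemma transform_inner_eq:
  "f \<in> L2 M \<Longrightarrow> g \<in> L2 M \<Longrightarrow>
    transform_inner (L2_transform M f) (L2_transform M g) = L2_inner M f g"
  unfolding transform_inner_def by (intro L2_inner_cong_AE L2_preimage)

text \<open>The inner product is transported so that the transform preserves it. Completeness then
  comes from Riesz-Fischer, and the reproducing property from the kernel functions being transforms
  of indicators.\<close>

lemma reproducing_kernel_space_L2_transform:
  "reproducing_kernel_space (fin_sets M) (inter_kernel M) (L2_transform M ` L2 M) transform_inner"
proof
  let ?T = "L2_transform M" and ?ip = transform_inner
  show "f x = 0" if "f \<in> ?T ` L2 M" "x \<notin> fin_sets M" for f x
    using that by (auto simp: L2_transform_eq)
  show "(\<lambda>x. 0) \<in> ?T ` L2 M"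
    by (rule image_eqI[where x = "\<lambda>x. 0"]) (simp_all add: L2_transform_zero L2_zero)
  show "(\<lambda>x. f x + g x) \<in> ?T ` L2 M" if "f \<in> ?T ` L2 M" "g \<in> ?T ` L2 M" for f g
    using that by (auto simp: L2_transform_add intro: L2_add)
  show "(\<lambda>x. c * f x) \<in> ?T ` L2 M" if "f \<in> ?T ` L2 M" for c f
    using that by (auto simp: L2_transform_scale intro: L2_scale)
  show "?ip (\<lambda>x. f x + g x) k = ?ip f k + ?ip g k"
    if "f \<in> ?T ` L2 M" "g \<in> ?T ` L2 M" "k \<in> ?T ` L2 M" for f g k
    using that by (auto simp: L2_transform_add transform_inner_eq L2_add L2_inner_add_left)
  show "?ip (\<lambda>x. c * f x) g = c * ?ip f g" if "f \<in> ?T ` L2 M" "g \<in> ?T ` L2 M" for c f g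
    using that by (auto simp: L2_transform_scale transform_inner_eq L2_scale L2_inner_scale_left)
  show "?ip g f = cnj (?ip f g)" if "f \<in> ?T ` L2 M" "g \<in> ?T ` L2 M" for f g
    using that by (auto simp: transform_inner_eq intro: L2_inner_commute)
  show "Re (?ip f f) > 0" if f: "f \<in> ?T ` L2 M" "f \<noteq> (\<lambda>x. 0)" for f
  proof -
    obtain h where h: "h \<in> L2 M" "f = ?T h" using f(1) by auto
    \<comment> \<open>A function vanishing almost everywhere has transform 0, which \<open>f\<close>
      is not.\<close>
    have "\<not> (AE x in M. h x = 0)"
    proof
      assume "AE x in M. h x = 0"
      then have "L2_inner M h (indicator A) = L2_inner M (\<lambda>x. 0) (indicator A)" if "A \<in> fin_sets M" for A
        using h(1) L2_zero L2_indicator[OF that] by (intro L2_inner_cong_AE) auto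
      then have "?T h = ?T (\<lambda>x. 0)" by (auto simp: L2_transform_eq)
      then show False using f(2) h(2) by (simp add: L2_transform_zero)
    qed
    then have "L2_sq M h \<noteq> 0" using h(1) by (simp add: L2_sq_eq_0_iff)
    then show ?thesis using L2_sq_nonneg[of M h] by (simp add: h transform_inner_eq L2_inner_self)
  qed
  show "zero_off (fin_sets M) (\<lambda>x. inter_kernel M x y) \<in> ?T ` L2 M" if "y \<in> fin_sets M" for y
    using that by (simp add: L2_transform_indicator L2_indicator)
  show "?ip f (zero_off (fin_sets M) (\<lambda>x. inter_kernel M x y)) = f y"
    if "f \<in> ?T ` L2 M" "y \<in> fin_sets M" for f y
    using that
    by (auto simp: L2_transform_indicator transform_inner_eq L2_indicator) (simp add: L2_transform_eq)
  fix F :: "nat \<Rightarrow> 'a set \<Rightarrow> complex"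
  assume F: "\<And>n. F n \<in> ?T ` L2 M" and Cauchy: "\<And>e. e > 0 \<Longrightarrow> \<exists>N. \<forall>m\<ge>N. \<forall>n\<ge>N.
      sqrt (Re (?ip (\<lambda>x. F m x - F n x) (\<lambda>x. F m x - F n x))) < e"
  from F have "\<forall>n. \<exists>h. h \<in> L2 M \<and> F n = ?T h" by blast
  then obtain G where G: "\<And>n. G n \<in> L2 M" and FG: "\<And>n. F n = ?T (G n)" by metis
  \<comment> \<open>A general \<open>g\<close> covers both differences of two terms of the sequence
    and the distance to the limit.\<close>
  have sq: "Re (?ip (\<lambda>x. F n x - ?T g x) (\<lambda>x. F n x - ?T g x)) = L2_sq M (\<lambda>x. G n x - g x)"
    if "g \<in> L2 M" for n g
    using that by (simp add: FG L2_transform_diff G L2_diff transform_inner_eq L2_inner_self)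
  obtain g where g: "g \<in> L2 M" "(\<lambda>n. L2_sq M (\<lambda>x. G n x - g x)) \<longlonglongrightarrow> 0"
  proof (rule Riesz_Fischer[of G M, OF G])
    fix e :: real assume "e > 0"
    \<comment> \<open>The Cauchy hypothesis concerns norms and Riesz-Fischer squared norms, hence
      \<open>sqrt e\<close>.\<close>
    then obtain N where "\<forall>m\<ge>N. \<forall>n\<ge>N. sqrt (Re (?ip (\<lambda>x. F m x - F n x) (\<lambda>x. F m x - F n x))) < sqrt e"
      using Cauchy[of "sqrt e"] by auto
    then show "\<exists>N. \<forall>m\<ge>N. \<forall>n\<ge>N. L2_sq M (\<lambda>x. G m x - G n x) < e"
      using sq[OF G, folded FG] by auto
  qed
  from tendsto_real_sqrt[OF g(2)]
  show "\<exists>f\<in>?T ` L2 M. (\<lambda>n. sqrt (Re (?ip (\<lambda>x. F n x - f x) (\<lambda>x. F n x - f x)))) \<longlonglongrightarrow> 0"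
    using g(1) by (intro bexI[of _ "?T g"]) (simp_all add: sq)
qed

text \<open>Uniqueness of the space with a given kernel identifies the constructed model with
  \<open>rkhs\<close>.\<close>

lemma rkhs_inter_kernel: "rkhs (fin_sets M) (inter_kernel M) = L2_transform M ` L2 M"
  by (rule rkhs_eqI[OF reproducing_kernel_space_L2_transform])

end

theorem theorem3p2:
  fixes \<mu> :: "'a measure" and M :: "'a set \<Rightarrow> complex"
  assumes "sigma_finite_measure \<mu>"
    and "\<And>A B. A \<in> fin_sets \<mu> \<Longrightarrow> B \<in> fin_sets \<mu> \<Longrightarrow> A \<inter> B = {} \<Longrightarrow> M (A \<union> B) = M A + M B"
    and "\<And>A. A \<in> fin_sets \<mu> \<Longrightarrow> emeasure \<mu> A = 0 \<Longrightarrow> M A = 0"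
  shows "((\<exists>h\<in>L2 \<mu>. \<forall>A\<in>fin_sets \<mu>. M A = (LINT x:A|\<mu>. h x)) \<longleftrightarrow> bounded_quadratic_sums \<mu> M) \<and>
         (bounded_quadratic_sums \<mu> M \<longleftrightarrow>
            zero_off (fin_sets \<mu>) M \<in> rkhs (fin_sets \<mu>) (inter_kernel \<mu>))"
proof -
  interpret \<mu>: sigma_finite_measure \<mu> by fact
  interpret additive_set_function \<mu> M using assms(2,3) by unfold_locales
  have "zero_off (fin_sets \<mu>) M = L2_transform \<mu> h \<longleftrightarrow>
      (\<forall>A\<in>fin_sets \<mu>. M A = (LINT x:A|\<mu>. h x))" for h
    by (auto simp: L2_transform_def zero_off_def fun_eq_iff)
  then have "zero_off (fin_sets \<mu>) M \<in> rkhs (fin_sets \<mu>) (inter_kernel \<mu>) \<longleftrightarrow>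
      (\<exists>h\<in>L2 \<mu>. \<forall>A\<in>fin_sets \<mu>. M A = (LINT x:A|\<mu>. h x))"
    by (auto simp: \<mu>.rkhs_inter_kernel image_iff)
  then show ?thesis using bounded_quadratic_sums_iff by simp
qed

end
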